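(* Every graph is exactly one of the following: (i) pentagon-vanishing; (ii) pentagon-periodic; (iii) pentagon-expanding.
   Context: For a graph $G$, the pentagon graph of $G$, denoted $\mathscr{C}_5(G)$, is the graph whose vertices are the induced cycles of length $5$ in $G$; two vertices of $\mathscr{C}_5(G)$ are adjacent if and only if the corresponding induced $5$-cycles share at least one common edge. If $G$ has no induced $5$-cycles, then $\mathscr{C}_5(G)$ is defined to be $\emptyset$ (the empty graph, with no vertices). The iterates are $\mathscr{C}_5^0(G)=G$ and $\mathscr{C}_5^{k+1}(G)=\mathscr{C}_5(\mathscr{C}_5^k(G))$ for $k\ge 0$. A graph $G$ is pentagon-vanishing if $\mathscr{C}_5^k(G)=\emptyset$ for some positive integer $k$. A graph $G$ is pentagon-periodic if there exist integers $m\ge 0$ and $p>0$ such that $\mathscr{C}_5^{n+p}(G)\cong \mathscr{C}_5^n(G)$ for all $n\ge m$. A graph $G$ is pentagon-expanding if $\lim_{k\to\infty}|V(\mathscr{C}_5^k(G))|=\infty$, where $V(H)$ denotes the vertex set of a graph $H$.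
   Formalization: Graphs are finite, and pentagon-periodic additionally requires the repeating iterates to be nonempty; otherwise every pentagon-vanishing graph (e.g. a single vertex) would also be pentagon-periodic and "exactly one" would fail. *)

theory Defs
  imports "Graph_Theory.Graph_Theory" "HOL-Library.FSet"
begin

text \<open>
  Graphs are finite, simple and undirected (locale \<^locale>\<open>pair_graph\<close>): an edge is
  represented by its two opposite arcs.  The graph without vertices is allowed.
\<close>

abbreviation graph_iso :: "'a pair_pre_digraph \<Rightarrow> 'b pair_pre_digraph \<Rightarrow> bool" where
  "graph_iso G H \<equiv> digraph_iso (with_proj G) (with_proj H)"

definition cycle_graph :: "nat \<Rightarrow> nat pair_pre_digraph" where
  "cycle_graph n = \<lparr> pverts = {..<n},
     parcs = {(i, j). i < n \<and> j < n \<and> (j = Suc i mod n \<or> i = Suc j mod n)} \<rparr>"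

definition induced_5_cycles :: "'a pair_pre_digraph \<Rightarrow> 'a pair_pre_digraph set" where
  "induced_5_cycles G =
     {C. induced_subgraph (with_proj C) (with_proj G) \<and> graph_iso (cycle_graph 5) C}"

definition pentagon_graph :: "'a pair_pre_digraph \<Rightarrow> 'a pair_pre_digraph pair_pre_digraph" where
  "pentagon_graph G = \<lparr> pverts = induced_5_cycles G,
     parcs = {(C, D). C \<in> induced_5_cycles G \<and> D \<in> induced_5_cycles G \<and> C \<noteq> D \<and>
                      parcs C \<inter> parcs D \<noteq> {}} \<rparr>"

text \<open>
  The operator \<^const>\<open>pentagon_graph\<close> changes the vertex type.  In order to iterate it, the
  vertices of all iterates are collected in one type: a vertex is either an original one or a
  pentagon, given by its vertices and its arcs.  The lemma \<open>graph_iso_pentagon_step\<close> below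
  states that this is only a renaming of the vertices.
\<close>

datatype 'a vertex =
  Original 'a
| Pentagon "'a vertex fset" "('a vertex \<times> 'a vertex) fset"

definition rename_verts :: "('a \<Rightarrow> 'b) \<Rightarrow> 'a pair_pre_digraph \<Rightarrow> 'b pair_pre_digraph" where
  "rename_verts f G = \<lparr> pverts = f ` pverts G, parcs = map_prod f f ` parcs G \<rparr>"

text \<open>Only applied to finite graphs, where \<^const>\<open>Abs_fset\<close> is injective.\<close>

definition pentagon_vertex :: "'a vertex pair_pre_digraph \<Rightarrow> 'a vertex" where
  "pentagon_vertex C = Pentagon (Abs_fset (pverts C)) (Abs_fset (parcs C))"

definition pentagon_step :: "'a vertex pair_pre_digraph \<Rightarrow> 'a vertex pair_pre_digraph" where
  "pentagon_step G = rename_verts pentagon_vertex (pentagon_graph G)"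

definition pentagon_iterate :: "nat \<Rightarrow> 'a pair_pre_digraph \<Rightarrow> 'a vertex pair_pre_digraph" where
  "pentagon_iterate k G = (pentagon_step ^^ k) (rename_verts Original G)"

definition pentagon_vanishing :: "'a pair_pre_digraph \<Rightarrow> bool" where
  "pentagon_vanishing G \<longleftrightarrow> (\<exists>k>0. pverts (pentagon_iterate k G) = {})"

text \<open>
  The repeating graphs are required to be nonempty.  Otherwise every pentagon-vanishing graph
  would be pentagon-periodic as well (with eventually empty iterates), and the two classes
  would not exclude each other.
\<close>

definition pentagon_periodic :: "'a pair_pre_digraph \<Rightarrow> bool" where
  "pentagon_periodic G \<longleftrightarrow>
     (\<exists>m p. p > 0 \<and>
        (\<forall>n\<ge>m. pverts (pentagon_iterate n G) \<noteq> {} \<and>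
                graph_iso (pentagon_iterate (n + p) G) (pentagon_iterate n G)))"

definition pentagon_expanding :: "'a pair_pre_digraph \<Rightarrow> bool" where
  "pentagon_expanding G \<longleftrightarrow>
     filterlim (\<lambda>k. card (pverts (pentagon_iterate k G))) at_top sequentially"

lemma graph_iso_rename_verts:
  assumes "pair_wf_digraph G" and "inj_on f (pverts G)"
  shows "graph_iso G (rename_verts f G)"
proof -
  interpret pair_wf_digraph G by fact
  let ?h = "\<lparr> iso_verts = f, iso_arcs = map_prod f f, iso_head = snd, iso_tail = fst \<rparr>"
  have "inj_on (map_prod f f) (parcs G)"
    by (rule inj_on_subset[OF map_prod_inj_on[OF assms(2) assms(2)]])
       (auto dest: wellformed')
  then have "pre_digraph.digraph_isomorphism (with_proj G) ?h"
    using assms by (simp add: pre_digraph.digraph_isomorphism_def wf_digraph_wp_iff)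
  moreover have "with_proj (rename_verts f G) = app_iso ?h (with_proj G)"
    by (simp add: app_iso_def with_proj_def rename_verts_def)
  ultimately show ?thesis
    unfolding digraph_iso_def by blast
qed

lemma graph_iso_pentagon_step:
  assumes "pair_graph G"
  shows "graph_iso (pentagon_graph G) (pentagon_step G)"
proof -
  interpret pair_graph G by fact
  have fin: "finite (pverts C)" "finite (parcs C)" if "C \<in> induced_5_cycles G" for C
    using that pair_finite_verts pair_finite_arcs
    by (auto simp: induced_5_cycles_def induced_subgraph_def subgraph_def intro: finite_subset)
  have "inj_on pentagon_vertex (pverts (pentagon_graph G))"
    by (rule inj_onI)
       (auto simp: pentagon_graph_def pentagon_vertex_def Abs_fset_inject fin)
  moreover have "pair_wf_digraph (pentagon_graph G)"
    by unfold_locales (auto simp: pentagon_graph_def)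
  ultimately show ?thesis
    unfolding pentagon_step_def by (intro graph_iso_rename_verts)
qed

end

(* If the numbers of vertices of the iterates do not tend to infinity, then infinitely many iterates
   have at most B vertices for some B.  Up to isomorphism there are only finitely many such graphs,
   so two iterates are isomorphic.  As the pentagon graph operator respects isomorphism, the sequence
   is periodic from the first of them on; once an iterate is empty, so are all later ones. *)

theory Submission
  imports Defs
begin

section \<open>Renaming of vertices and graph isomorphism\<close>

lemma rename_verts_simps [simp]:
  "pverts (rename_verts f G) = f ` pverts G"
  "parcs (rename_verts f G) = map_prod f f ` parcs G"
  by (simp_all add: rename_verts_def)

lemma rename_verts_comp: "rename_verts g (rename_verts f G) = rename_verts (g \<circ> f) G"
  by (simp add: rename_verts_def image_comp map_prod_compose)

text \<open>Well-formedness puts both ends of every arc among the vertices, so a map fixing the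
  vertices also fixes the arcs.\<close>

lemma (in pair_wf_digraph) rename_verts_ident:
  assumes "\<And>x. x \<in> pverts G \<Longrightarrow> f x = x"
  shows "rename_verts f G = G"
proof -
  have "map_prod f f e = e" if "e \<in> parcs G" for e
    using that assms arc_fst_in_verts arc_snd_in_verts by (cases e) fastforce
  then show ?thesis
    using assms by (simp add: rename_verts_def)
qed

lemma (in pair_wf_digraph) pair_wf_digraph_rename_verts:
  "pair_wf_digraph (rename_verts f G)"
  by unfold_locales (auto dest: arc_fst_in_verts arc_snd_in_verts)

lemma pair_wf_digraph_if_graph_iso:
  assumes "graph_iso G H"
  shows "pair_wf_digraph G"
  using assms
  by (auto simp: digraph_iso_def pre_digraph.digraph_isomorphism_def wf_digraph_wp_iff)

text \<open>The arc map of an isomorphism is a separate component, but arcs here are pairs of their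
  ends, so compatibility with tails and heads forces it to be \<open>map_prod\<close> of the vertex
  map. Invariance under isomorphism thus reduces to invariance under injective renaming.\<close>

lemma graph_isoE:
  assumes "graph_iso G H"
  obtains f where "inj_on f (pverts G)" "H = rename_verts f G"
proof -
  obtain h where h: "pre_digraph.digraph_isomorphism (with_proj G) h"
      "with_proj H = app_iso h (with_proj G)"
    using assms by (auto simp: digraph_iso_def)
  then have H: "pverts H = iso_verts h ` pverts G" "parcs H = iso_arcs h ` parcs G"
      "iso_tail h = fst" "iso_head h = snd"
    by (simp_all add: with_proj_def app_iso_def)
  have "iso_arcs h e = map_prod (iso_verts h) (iso_verts h) e" if "e \<in> parcs G" for e
    using that h(1) H(3,4)
    by (auto simp: pre_digraph.digraph_isomorphism_def intro!: prod_eqI)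
  then have "H = rename_verts (iso_verts h) G"
    using H by (simp add: rename_verts_def)
  moreover have "inj_on (iso_verts h) (pverts G)"
    using h(1) by (simp add: pre_digraph.digraph_isomorphism_def)
  ultimately show thesis
    using that by blast
qed

lemma graph_iso_sym: "graph_iso G H \<Longrightarrow> graph_iso H G"
  using digraph_iso_swap pair_wf_digraph_if_graph_iso wf_digraph_wp_iff by blast

lemma card_pverts_graph_iso: "graph_iso G H \<Longrightarrow> card (pverts H) = card (pverts G)"
  by (elim graph_isoE) (simp add: card_image)

text \<open>Injectivity prevents an arc from turning into a loop; finiteness and symmetry pass to
  images.\<close>

lemma pair_graph_rename_verts:
  assumes "pair_graph G" and f: "inj_on f (pverts G)"
  shows "pair_graph (rename_verts f G)"
proof -
  interpret pair_graph G by fact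
  interpret R: pair_wf_digraph "rename_verts f G"
    by (rule pair_wf_digraph_rename_verts)
  show ?thesis
  proof unfold_locales
    show "fst e \<noteq> snd e" if e: "e \<in> parcs (rename_verts f G)" for e
    proof -
      obtain a where a: "a \<in> parcs G" "e = map_prod f f a"
        using e by auto
      then show ?thesis
        using inj_onD[OF f, of "fst a" "snd a"] arc_fst_in_verts arc_snd_in_verts pair_no_loops
        by (auto simp: a(2))
    qed
    have "sym (parcs G)"
      using pair_sym_arcs by (simp add: symmetric_def)
    then show "symmetric (with_proj (rename_verts f G))"
      by (auto simp: symmetric_def sym_def)
  qed (simp_all add: pair_finite_verts pair_finite_arcs)
qed

section \<open>Induced 5-cycles under renaming\<close>

text \<open>The equation for \<open>parcs C\<close> expresses inducedness and at the same time
  yields the inclusion of arcs and the well-formedness of \<open>C\<close>.\<close>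

lemma mem_induced_5_cycles_iff:
  "C \<in> induced_5_cycles G \<longleftrightarrow>
     pair_wf_digraph G \<and> pverts C \<subseteq> pverts G \<and>
     parcs C = {e \<in> parcs G. fst e \<in> pverts C \<and> snd e \<in> pverts C} \<and>
     graph_iso (cycle_graph 5) C"
  by (auto simp: induced_5_cycles_def induced_subgraph_def subgraph_def compatible_def
      wf_digraph_wp_iff pair_wf_digraph_def)

lemma pair_wf_digraph_induced_5_cycle:
  "C \<in> induced_5_cycles G \<Longrightarrow> pair_wf_digraph C"
  by (auto simp: induced_5_cycles_def induced_subgraph_def subgraph_def wf_digraph_wp_iff)

lemma rename_verts_induced_5_cycle:
  assumes C: "C \<in> induced_5_cycles G" and f: "inj_on f (pverts G)"
  shows "rename_verts f C \<in> induced_5_cycles (rename_verts f G)"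
proof -
  interpret pair_wf_digraph G
    using C by (simp add: mem_induced_5_cycles_iff)
  have sub: "pverts C \<subseteq> pverts G"
    and arcs: "parcs C = {e \<in> parcs G. fst e \<in> pverts C \<and> snd e \<in> pverts C}"
    and cyc: "graph_iso (cycle_graph 5) C"
    using C by (auto simp: mem_induced_5_cycles_iff)
  have "graph_iso C (rename_verts f C)"
    using pair_wf_digraph_induced_5_cycle[OF C] inj_on_subset[OF f sub]
    by (rule graph_iso_rename_verts)
  with cyc have cyc': "graph_iso (cycle_graph 5) (rename_verts f C)"
    by (rule digraph_iso_trans)
  \<comment> \<open>Injectivity on all of \<open>pverts G\<close> keeps vertices outside
    \<open>C\<close> from landing in the image of \<open>C\<close>, so the image induces no
    additional arcs.\<close>
  have "f x \<in> f ` pverts C \<longleftrightarrow> x \<in> pverts C" if "x \<in> pverts G" for x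
    using inj_on_image_mem_iff[OF f that sub] .
  then have "{e \<in> parcs G. fst e \<in> pverts C \<and> snd e \<in> pverts C} =
      {e \<in> parcs G. f (fst e) \<in> f ` pverts C \<and> f (snd e) \<in> f ` pverts C}"
    using arc_fst_in_verts arc_snd_in_verts by (metis (lifting))
  then have "map_prod f f ` parcs C =
      {e \<in> map_prod f f ` parcs G. fst e \<in> f ` pverts C \<and> snd e \<in> f ` pverts C}"
    unfolding arcs by auto
  with cyc' show ?thesis
    using sub pair_wf_digraph_rename_verts[of f] by (auto simp: mem_induced_5_cycles_iff)
qed

text \<open>The inverse is taken on all of \<open>pverts G\<close>, so that a single map undoes the
  renaming of every subgraph at once.\<close>

lemma rename_verts_inverse:
  assumes "pair_wf_digraph C" and "pverts C \<subseteq> pverts G" and "inj_on f (pverts G)"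
  shows "rename_verts (the_inv_into (pverts G) f) (rename_verts f C) = C"
  unfolding rename_verts_comp
  using assms by (intro pair_wf_digraph.rename_verts_ident) (auto simp: the_inv_into_f_f)

lemma induced_5_cycles_rename_verts:
  assumes G: "pair_wf_digraph G" and f: "inj_on f (pverts G)"
  shows "induced_5_cycles (rename_verts f G) = rename_verts f ` induced_5_cycles G"
proof (intro equalityI subsetI)
  fix D assume D: "D \<in> induced_5_cycles (rename_verts f G)"
  \<comment> \<open>The reverse inclusion is the forward one applied to the inverse
    renaming.\<close>
  let ?g = "the_inv_into (pverts G) f"
  have "rename_verts ?g D \<in> induced_5_cycles (rename_verts ?g (rename_verts f G))"
    using D by (rule rename_verts_induced_5_cycle) (simp add: f inj_on_the_inv_into)
  then have "rename_verts ?g D \<in> induced_5_cycles G"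
    using G f by (simp add: rename_verts_inverse)
  moreover have "rename_verts f (rename_verts ?g D) = D"
    unfolding rename_verts_comp
    using D f pair_wf_digraph_induced_5_cycle[OF D]
    by (intro pair_wf_digraph.rename_verts_ident)
       (auto simp: mem_induced_5_cycles_iff f_the_inv_into_f)
  ultimately show "D \<in> rename_verts f ` induced_5_cycles G"
    by (metis imageI)
qed (auto intro: rename_verts_induced_5_cycle[OF _ f])

section \<open>Invariance of the pentagon graph under isomorphism\<close>

lemma pentagon_graph_simps [simp]:
  "pverts (pentagon_graph G) = induced_5_cycles G"
  "parcs (pentagon_graph G) = {(C, D). C \<in> induced_5_cycles G \<and> D \<in> induced_5_cycles G \<and>
     C \<noteq> D \<and> parcs C \<inter> parcs D \<noteq> {}}"
  by (simp_all add: pentagon_graph_def)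

lemma pair_wf_digraph_pentagon_graph: "pair_wf_digraph (pentagon_graph G)"
  by unfold_locales auto

lemma inj_on_rename_verts_induced_5_cycles:
  assumes "inj_on f (pverts G)"
  shows "inj_on (rename_verts f) (induced_5_cycles G)"
  using assms
  by (intro inj_on_inverseI[where g = "rename_verts (the_inv_into (pverts G) f)"]
      rename_verts_inverse)
     (auto simp: mem_induced_5_cycles_iff pair_wf_digraph_induced_5_cycle)

text \<open>Naturality of the operator. The vertices of a pentagon graph are themselves graphs, so
  the induced renaming on them is \<open>rename_verts f\<close>. It respects adjacency because
  injectivity of \<open>f\<close> preserves and reflects both distinctness and the sharing of
  arcs.\<close>

lemma pentagon_graph_rename_verts:
  assumes G: "pair_wf_digraph G" and f: "inj_on f (pverts G)"
  shows "pentagon_graph (rename_verts f G) = rename_verts (rename_verts f) (pentagon_graph G)"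
proof -
  have eq_iff: "rename_verts f C = rename_verts f D \<longleftrightarrow> C = D"
    if "C \<in> induced_5_cycles G" "D \<in> induced_5_cycles G" for C D
    using inj_on_rename_verts_induced_5_cycles[OF f] that by (auto dest: inj_onD)
  \<comment> \<open>Images commute with intersections only under injectivity, here of
    \<open>map_prod f f\<close> on a set containing both arc sets.\<close>
  have inter: "map_prod f f ` parcs C \<inter> map_prod f f ` parcs D = map_prod f f ` (parcs C \<inter> parcs D)"
    if "C \<in> induced_5_cycles G" "D \<in> induced_5_cycles G" for C D
  proof (rule inj_on_image_Int[symmetric])
    show "inj_on (map_prod f f) (pverts G \<times> pverts G)"
      using f f by (rule map_prod_inj_on)
    show "parcs C \<subseteq> pverts G \<times> pverts G" "parcs D \<subseteq> pverts G \<times> pverts G"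
      using that unfolding mem_induced_5_cycles_iff by fastforce+
  qed
  let ?r = "rename_verts f"
  have "parcs (pentagon_graph (rename_verts f G)) =
      {(C', D'). C' \<in> ?r ` induced_5_cycles G \<and> D' \<in> ?r ` induced_5_cycles G \<and>
         C' \<noteq> D' \<and> parcs C' \<inter> parcs D' \<noteq> {}}"
    by (simp add: induced_5_cycles_rename_verts[OF G f])
  also have "\<dots> = {(?r C, ?r D) | C D. C \<in> induced_5_cycles G \<and> D \<in> induced_5_cycles G \<and>
         ?r C \<noteq> ?r D \<and> parcs (?r C) \<inter> parcs (?r D) \<noteq> {}}"
    by blast
  also have "\<dots> = {(?r C, ?r D) | C D. C \<in> induced_5_cycles G \<and> D \<in> induced_5_cycles G \<and>
         C \<noteq> D \<and> parcs C \<inter> parcs D \<noteq> {}}"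
  proof -
    have "?r C \<noteq> ?r D \<and> parcs (?r C) \<inter> parcs (?r D) \<noteq> {} \<longleftrightarrow> C \<noteq> D \<and> parcs C \<inter> parcs D \<noteq> {}"
      if "C \<in> induced_5_cycles G" "D \<in> induced_5_cycles G" for C D
      using that by (simp add: eq_iff inter)
    then show ?thesis
      by blast
  qed
  also have "\<dots> = map_prod ?r ?r ` parcs (pentagon_graph G)"
    by auto
  finally show ?thesis
    by (simp add: rename_verts_def[of "rename_verts f"] pentagon_graph_def[of "rename_verts f G"]
        induced_5_cycles_rename_verts[OF G f])
qed

lemma graph_iso_pentagon_graph:
  assumes "graph_iso G H"
  shows "graph_iso (pentagon_graph G) (pentagon_graph H)"
  using assms
proof (rule graph_isoE)
  fix f assume f: "inj_on f (pverts G)" and H: "H = rename_verts f G"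
  have "inj_on (rename_verts f) (pverts (pentagon_graph G))"
    using inj_on_rename_verts_induced_5_cycles[OF f] by simp
  then show ?thesis
    unfolding H pentagon_graph_rename_verts[OF pair_wf_digraph_if_graph_iso[OF assms] f]
    by (intro graph_iso_rename_verts pair_wf_digraph_pentagon_graph)
qed

text \<open>The chain runs through \<open>pentagon_graph G\<close> and
  \<open>pentagon_graph H\<close>; its outer links are the encoding of pentagons as vertices of type
  \<open>'a vertex\<close>.\<close>

lemma pentagon_step_graph_iso:
  assumes "pair_graph G" "pair_graph H" "graph_iso G H"
  shows "graph_iso (pentagon_step G) (pentagon_step H)"
  using graph_iso_sym[OF graph_iso_pentagon_step[OF assms(1)]]
    graph_iso_pentagon_graph[OF assms(3)] graph_iso_pentagon_step[OF assms(2)]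
  by (blast intro: digraph_iso_trans)

lemma pair_graph_graph_iso:
  assumes "pair_graph G" "graph_iso G H"
  shows "pair_graph H"
  using assms by (metis graph_isoE pair_graph_rename_verts)

lemma pair_graph_pentagon_graph:
  assumes "pair_graph G"
  shows "pair_graph (pentagon_graph G)"
proof -
  interpret pair_graph G by fact
  \<comment> \<open>A pentagon is determined by its vertex set and its arc set, which leaves
    finitely many choices.\<close>
  have "induced_5_cycles G \<subseteq> (\<lambda>(V, A). \<lparr>pverts = V, parcs = A\<rparr>) ` (Pow (pverts G) \<times> Pow (parcs G))"
  proof
    fix C assume "C \<in> induced_5_cycles G"
    then have "(pverts C, parcs C) \<in> Pow (pverts G) \<times> Pow (parcs G)"
      by (auto simp: mem_induced_5_cycles_iff)
    then show "C \<in> (\<lambda>(V, A). \<lparr>pverts = V, parcs = A\<rparr>) ` (Pow (pverts G) \<times> Pow (parcs G))"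
      by (rule rev_image_eqI) simp
  qed
  then have fin: "finite (induced_5_cycles G)"
    by (rule finite_subset) (simp add: pair_finite_verts pair_finite_arcs)
  interpret P: pair_wf_digraph "pentagon_graph G"
    by (rule pair_wf_digraph_pentagon_graph)
  show ?thesis
  proof unfold_locales
    show "finite (parcs (pentagon_graph G))"
      by (rule finite_subset[of _ "induced_5_cycles G \<times> induced_5_cycles G"]) (auto simp: fin)
    show "symmetric (with_proj (pentagon_graph G))"
      by (auto simp: symmetric_def sym_def)
  qed (auto simp: fin)
qed

section \<open>The sequence of iterates\<close>

lemma pentagon_iterate_Suc: "pentagon_iterate (Suc k) G = pentagon_step (pentagon_iterate k G)"
  by (simp add: pentagon_iterate_def)

lemma pair_graph_pentagon_iterate:
  assumes "pair_graph G"
  shows "pair_graph (pentagon_iterate k G)"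
proof (induction k)
  case 0
  show ?case
    using assms by (simp add: pentagon_iterate_def pair_graph_rename_verts inj_on_def)
next
  case (Suc k)
  then show ?case
    unfolding pentagon_iterate_Suc
    using pair_graph_graph_iso[OF pair_graph_pentagon_graph graph_iso_pentagon_step] by blast
qed

lemma pentagon_iterate_graph_iso_shift:
  assumes G: "pair_graph G"
    and iso: "graph_iso (pentagon_iterate i G) (pentagon_iterate j G)"
  shows "graph_iso (pentagon_iterate (i + k) G) (pentagon_iterate (j + k) G)"
  by (induction k)
     (simp_all add: iso pentagon_iterate_Suc pentagon_step_graph_iso pair_graph_pentagon_iterate[OF G])

lemma induced_5_cycles_empty:
  assumes "pverts G = {}"
  shows "induced_5_cycles G = {}"
proof -
  \<comment> \<open>The isomorphism gives \<open>C\<close> five vertices, whereas a subgraph of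
    \<open>G\<close> has none.\<close>
  have False if C: "C \<in> induced_5_cycles G" for C
    using card_pverts_graph_iso[of "cycle_graph 5" C] C assms
    by (simp add: mem_induced_5_cycles_iff cycle_graph_def)
  then show ?thesis
    by blast
qed

lemma pentagon_iterate_empty_mono:
  assumes "pverts (pentagon_iterate k G) = {}" and "k \<le> n"
  shows "pverts (pentagon_iterate n G) = {}"
  using assms(2)
  by (induction n rule: dec_induct)
     (simp_all add: assms(1) pentagon_iterate_Suc pentagon_step_def induced_5_cycles_empty)

section \<open>Finitely many graphs of bounded size\<close>

text \<open>Numbering the vertices gives representatives in one common type, so that graphs of
  bounded size fall into one finite set.\<close>

lemma ex_graph_iso_on_lessThan:
  assumes "pair_graph G"
  shows "\<exists>H :: nat pair_pre_digraph. graph_iso G H \<and> pverts H = {..<card (pverts G)}"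
proof -
  interpret pair_graph G by fact
  obtain f where f: "bij_betw f (pverts G) {..<card (pverts G)}"
    using ex_bij_betw_finite_nat[OF pair_finite_verts] by (auto simp: lessThan_atLeast0)
  have "graph_iso G (rename_verts f G)"
    using f by (intro graph_iso_rename_verts pair_wf_digraph) (auto simp: bij_betw_def)
  moreover have "pverts (rename_verts f G) = {..<card (pverts G)}"
    using f by (simp add: bij_betw_def)
  ultimately show ?thesis
    by blast
qed

lemma finite_pair_wf_digraphs_on_subsets:
  assumes "finite V"
  shows "finite {H. pair_wf_digraph H \<and> pverts H \<subseteq> V}"
proof (rule finite_subset)
  show "{H. pair_wf_digraph H \<and> pverts H \<subseteq> V}
      \<subseteq> (\<lambda>(W, A). \<lparr>pverts = W, parcs = A\<rparr>) ` (Pow V \<times> Pow (V \<times> V))"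
  proof
    fix H assume "H \<in> {H. pair_wf_digraph H \<and> pverts H \<subseteq> V}"
    \<comment> \<open>Well-formedness confines the arcs to pairs from \<open>V\<close>.\<close>
    then have "(pverts H, parcs H) \<in> Pow V \<times> Pow (V \<times> V)"
      by (fastforce simp: pair_wf_digraph_def)
    then show "H \<in> (\<lambda>(W, A). \<lparr>pverts = W, parcs = A\<rparr>) ` (Pow V \<times> Pow (V \<times> V))"
      by (rule rev_image_eqI) simp
  qed
qed (simp add: assms)

text \<open>Pigeonhole: the numbered representatives of the graphs indexed by \<open>K\<close> lie
  in a finite set, so two of them coincide.\<close>

lemma ex_graph_iso_if_card_bounded:
  fixes F :: "nat \<Rightarrow> 'a pair_pre_digraph"
  assumes F: "\<And>k. pair_graph (F k)"
    and K: "infinite K" "\<And>k. k \<in> K \<Longrightarrow> card (pverts (F k)) \<le> B"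
  shows "\<exists>i j. i < j \<and> graph_iso (F i) (F j)"
proof -
  obtain H :: "nat \<Rightarrow> nat pair_pre_digraph"
    where H: "\<And>k. graph_iso (F k) (H k)" "\<And>k. pverts (H k) = {..<card (pverts (F k))}"
    using ex_graph_iso_on_lessThan[OF F] by metis
  have "H ` K \<subseteq> {H. pair_wf_digraph H \<and> pverts H \<subseteq> {..<B}}"
    using K(2) H(2) pair_wf_digraph_if_graph_iso[OF graph_iso_sym[OF H(1)]] by fastforce
  then have "finite (H ` K)"
    using finite_pair_wf_digraphs_on_subsets finite_subset by blast
  then have "\<not> inj_on H K"
    using K(1) finite_imageD by blast
  \<comment> \<open>The two indices are distinct and play symmetric roles, so they can be
    ordered.\<close>
  then obtain i j where ij: "H i = H j" "i < j"
    unfolding inj_on_def by (metis linorder_neqE_nat)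
  have "graph_iso (F i) (F j)"
    using H(1)[of i] graph_iso_sym[OF H(1)[of j]] ij(1) by (auto intro: digraph_iso_trans)
  with ij(2) show ?thesis
    by blast
qed

section \<open>Periodicity from one repetition\<close>

lemma pentagon_periodic_if_graph_iso:
  assumes G: "pair_graph G" and "\<not> pentagon_vanishing G"
    and ij: "i < j" "graph_iso (pentagon_iterate i G) (pentagon_iterate j G)"
  shows "pentagon_periodic G"
  unfolding pentagon_periodic_def
proof (intro exI conjI allI impI)
  \<comment> \<open>The witnesses are the starting index \<open>i\<close> and the period
    \<open>j - i\<close>.\<close>
  show "j - i > 0"
    using ij(1) by simp
  fix n assume n: "i \<le> n"
  show "pverts (pentagon_iterate n G) \<noteq> {}"
    \<comment> \<open>Vanishing asks for a positive exponent and \<open>n\<close> may be 0, so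
      emptiness is passed on to \<open>Suc n\<close>.\<close>
    using assms(2) pentagon_iterate_empty_mono[of n G "Suc n"]
    by (auto simp: pentagon_vanishing_def)
  \<comment> \<open>Shifting the given isomorphism by \<open>n - i\<close> moves \<open>i\<close> to
    \<open>n\<close> and \<open>j\<close> to \<open>n + (j - i)\<close>.\<close>
  have "j + (n - i) = n + (j - i)"
    using n ij(1) by simp
  then show "graph_iso (pentagon_iterate (n + (j - i)) G) (pentagon_iterate n G)"
    using pentagon_iterate_graph_iso_shift[OF G ij(2), of "n - i"] n
    by (simp add: graph_iso_sym)
qed

section \<open>Mutual exclusion and the trichotomy\<close>

lemma not_pentagon_expanding_if_pentagon_vanishing:
  assumes "pentagon_vanishing G"
  shows "\<not> pentagon_expanding G"
proof
  assume "pentagon_expanding G"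
  then have "\<forall>\<^sub>F n in sequentially. 1 \<le> card (pverts (pentagon_iterate n G))"
    by (simp add: pentagon_expanding_def filterlim_at_top)
  moreover obtain k where "pverts (pentagon_iterate k G) = {}"
    using assms by (auto simp: pentagon_vanishing_def)
  then have "\<forall>\<^sub>F n in sequentially. pverts (pentagon_iterate n G) = {}"
    by (auto intro!: eventually_sequentiallyI[of k] dest: pentagon_iterate_empty_mono)
  \<comment> \<open>The vertex count would eventually be both zero and at least one.\<close>
  ultimately have "\<forall>\<^sub>F n in sequentially. False"
    by eventually_elim simp
  then show False
    by simp
qed

lemma not_pentagon_expanding_if_pentagon_periodic:
  assumes "pentagon_periodic G"
  shows "\<not> pentagon_expanding G"
proof
  let ?c = "\<lambda>k. card (pverts (pentagon_iterate k G))"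
  obtain m p where "p > 0"
    and iso: "\<And>n. n \<ge> m \<Longrightarrow> graph_iso (pentagon_iterate (n + p) G) (pentagon_iterate n G)"
    using assms by (auto simp: pentagon_periodic_def)
  \<comment> \<open>Isomorphic graphs have equally many vertices, so the count is constant along an
    arithmetic progression of step \<open>p\<close>.\<close>
  have eq: "?c (m + q * p) = ?c m" for q
  proof (induction q)
    case (Suc q)
    have "?c (m + q * p + p) = ?c (m + q * p)"
      using card_pverts_graph_iso[OF iso[of "m + q * p"]] by simp
    with Suc show ?case
      by (simp add: ac_simps)
  qed simp
  assume "pentagon_expanding G"
  then have "\<forall>\<^sub>F n in sequentially. Suc (?c m) \<le> ?c n"
    by (simp add: pentagon_expanding_def filterlim_at_top)
  then obtain N where N: "\<And>n. n \<ge> N \<Longrightarrow> Suc (?c m) \<le> ?c n"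
    by (auto simp: eventually_sequentially)
  \<comment> \<open>As \<open>p\<close> is positive, \<open>N\<close> periods after \<open>m\<close>
    lead past any threshold \<open>N\<close>.\<close>
  have "N \<le> m + N * p"
    using \<open>p > 0\<close> by (simp add: trans_le_add2)
  from N[OF this] show False
    using eq by simp
qed

theorem theorem4p1:
  fixes G :: "'a pair_pre_digraph"
  assumes "pair_graph G"
  shows "(pentagon_vanishing G \<or> pentagon_periodic G \<or> pentagon_expanding G) \<and>
         \<not> (pentagon_vanishing G \<and> pentagon_periodic G) \<and>
         \<not> (pentagon_vanishing G \<and> pentagon_expanding G) \<and>
         \<not> (pentagon_periodic G \<and> pentagon_expanding G)"
proof (intro conjI)
  show "pentagon_vanishing G \<or> pentagon_periodic G \<or> pentagon_expanding G"
  proof (rule ccontr)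
    assume neg: "\<not> ?thesis"
    \<comment> \<open>Failure to tend to infinity means that some bound \<open>B\<close> is undercut
      at arbitrarily late indices.\<close>
    then obtain B where B: "\<exists>\<^sub>F k in sequentially. card (pverts (pentagon_iterate k G)) < B"
      by (auto simp: pentagon_expanding_def filterlim_at_top frequently_def not_less)
    have "infinite {k. card (pverts (pentagon_iterate k G)) < B}"
      using B by (simp flip: cofinite_eq_sequentially add: frequently_cofinite)
    then obtain i j where "i < j" "graph_iso (pentagon_iterate i G) (pentagon_iterate j G)"
      using ex_graph_iso_if_card_bounded[of "\<lambda>k. pentagon_iterate k G" _ B]
        pair_graph_pentagon_iterate[OF assms]
      by (metis (lifting) mem_Collect_eq less_imp_le)
    then show False
      using pentagon_periodic_if_graph_iso[OF assms] neg by blast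
  qed
  show "\<not> (pentagon_vanishing G \<and> pentagon_periodic G)"
  proof
    assume "pentagon_vanishing G \<and> pentagon_periodic G"
    then obtain k m where "pverts (pentagon_iterate k G) = {}"
      and "\<And>n. n \<ge> m \<Longrightarrow> pverts (pentagon_iterate n G) \<noteq> {}"
      unfolding pentagon_vanishing_def pentagon_periodic_def by metis
    then show False
      \<comment> \<open>At index \<open>max k m\<close> the iterate would be both empty and
        nonempty.\<close>
      using pentagon_iterate_empty_mono[of k G "max k m"] by simp
  qed
  show "\<not> (pentagon_vanishing G \<and> pentagon_expanding G)"
    using not_pentagon_expanding_if_pentagon_vanishing by blast
  show "\<not> (pentagon_periodic G \<and> pentagon_expanding G)"
    using not_pentagon_expanding_if_pentagon_periodic by blast
qed

end
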